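(* Let $n$ be a positive integer, let $0<\alpha_1<1$ and $\alpha_k\ge 0$ for $2\le k\le n$ be real numbers with $\sum_{k=1}^{n}\alpha_k=1$. Let $J=[c,d]$ with $0<c<d<\infty$ and let $0<\delta\le 1\le M$. Put $$K_0:=\sum_{k=1}^{n}\alpha_k\delta^{k-1},\qquad K_1:=\sum_{k=1}^{n}\alpha_kM^{k-1},\qquad K_2:=\sum_{k=2}^{n}\alpha_k\Big(\sum_{j=0}^{k-2}M^j\Big).$$ Let $G\in\mathcal{G}_J(K_1\delta,K_0M)$. If $K_2<K_0$, then the equation $$(g(x))^{\alpha_1}(g^{2}(x))^{\alpha_2}\cdots(g^{n}(x))^{\alpha_n}=G(x),\qquad x\in\mathbb{R}_+,$$ has a unique solution $g$ in $\mathcal{G}_J(\delta,M)$.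
   Context: $\mathbb{R}_+:=(0,+\infty)$. For a self-map $g$, $g^k$ denotes the $k$-th iterate ($g^0=\mathrm{id}$, $g^{k+1}=g\circ g^k$), while $(g^k(x))^{\alpha}$ denotes a real power of the number $g^k(x)$. $\mathcal{C}_b(\mathbb{R}_+)$ is the set of all bounded continuous self-maps of $\mathbb{R}_+$, and $\mathcal{R}(g)$ is the range of $g$. For a compact interval $J=[c,d]\subset\mathbb{R}_+$ with $c<d$ and for real numbers $\delta,M\ge 0$, $$\mathcal{G}_J(\delta,M):=\Big\{g\in\mathcal{C}_b(\mathbb{R}_+):\ \mathcal{R}(g)=J,\ g(c)=c,\ g(d)=d,\ \Big(\tfrac{x}{y}\Big)^{\delta}\le\tfrac{g(x)}{g(y)}\le\Big(\tfrac{x}{y}\Big)^{M}\ \forall x,y\in J\text{ with }x\ge y\Big\}.$$ *)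

theory Defs
  imports "HOL-Analysis.Analysis"
begin

abbreviation Rplus :: "real set" where
  "Rplus \<equiv> {0<..}"

text \<open>
  Self-maps of the positive half-line are elements of the extensional function space
  \<open>Rplus \<rightarrow>\<^sub>E Rplus\<close>, i.e. they have the fixed value \<open>undefined\<close> off \<open>Rplus\<close>. Hence HOL equality of
  two such maps is equality on \<open>Rplus\<close>. As they preserve \<open>Rplus\<close>, \<open>g ^^ k\<close> agrees there with the
  iterate of the self-map.
\<close>

definition Cb_Rplus :: "(real \<Rightarrow> real) set" where
  "Cb_Rplus = {g \<in> Rplus \<rightarrow>\<^sub>E Rplus. continuous_on Rplus g \<and> bounded (g ` Rplus)}"

definition GJ :: "real \<Rightarrow> real \<Rightarrow> real \<Rightarrow> real \<Rightarrow> (real \<Rightarrow> real) set" where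
  "GJ c d \<delta> M = {g \<in> Cb_Rplus. g ` Rplus = {c..d} \<and> g c = c \<and> g d = d \<and>
     (\<forall>x\<in>{c..d}. \<forall>y\<in>{c..d}. x \<ge> y \<longrightarrow>
        (x / y) powr \<delta> \<le> g x / g y \<and> g x / g y \<le> (x / y) powr M)}"

end

theory Submission
  imports Defs
begin

text \<open>
  In the coordinate \<open>t = ln x\<close> the equation reads \<open>\<Sum>i<n. w i * (h ^^ i) (h t) = H t\<close> with
  \<open>w i = \<alpha> (i + 1)\<close>, and the power bounds become slope bounds. Freezing \<open>h\<close> in the weighted sum
  \<open>L h = (\<Sum>i<n. w i * h ^^ i)\<close> gives an increasing bijection of \<open>[ln c, ln d]\<close> with slopes in
  \<open>[K0, K1]\<close>, so the solutions are the fixed points of \<open>h \<mapsto> (L h)\<inverse> \<circ> H\<close>. This operator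
  preserves the slope bounds \<open>[\<delta>, M]\<close> and contracts the sup distance by the factor \<open>K2 / K0\<close>.
\<close>

section \<open>Interval self-maps with two-sided slope bounds, and their iterates\<close>

text \<open>The maps live on the whole line but the slopes are controlled on [a,b] only, mirroring
  \<open>GJ\<close>, whose members act on all of \<open>Rplus\<close> with power bounds on J.
  Continuity off [a,b] is treated separately, in \<open>solution_continuous\<close>.\<close>

definition slope_class :: "real \<Rightarrow> real \<Rightarrow> real \<Rightarrow> real \<Rightarrow> (real \<Rightarrow> real) \<Rightarrow> bool" where
  "slope_class a b \<delta> M h \<longleftrightarrow> range h \<subseteq> {a..b} \<and> h a = a \<and> h b = b \<and>
     (\<forall>x\<in>{a..b}. \<forall>y\<in>{a..b}. y \<le> x \<longrightarrow> \<delta> * (x - y) \<le> h x - h y \<and> h x - h y \<le> M * (x - y))"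

lemma slope_class_in: "slope_class a b \<delta> M h \<Longrightarrow> h x \<in> {a..b}"
  unfolding slope_class_def by blast

lemma slope_class_lower:
  "slope_class a b \<delta> M h \<Longrightarrow> x \<in> {a..b} \<Longrightarrow> y \<in> {a..b} \<Longrightarrow> y \<le> x \<Longrightarrow> \<delta> * (x - y) \<le> h x - h y"
  unfolding slope_class_def by blast

lemma slope_class_upper:
  "slope_class a b \<delta> M h \<Longrightarrow> x \<in> {a..b} \<Longrightarrow> y \<in> {a..b} \<Longrightarrow> y \<le> x \<Longrightarrow> h x - h y \<le> M * (x - y)"
  unfolding slope_class_def by blast

lemma slope_class_lipschitz:
  assumes "slope_class a b \<delta> M h" "0 \<le> \<delta>" "x \<in> {a..b}" "y \<in> {a..b}"
  shows "\<bar>h x - h y\<bar> \<le> M * \<bar>x - y\<bar>"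
proof -
  have *: "\<bar>h x - h y\<bar> \<le> M * \<bar>x - y\<bar>" if "x \<in> {a..b}" "y \<in> {a..b}" "y \<le> x" for x y
  proof -
    have "0 \<le> \<delta> * (x - y)" using that assms(2) by simp
    then show ?thesis
      using slope_class_lower[OF assms(1) that] slope_class_upper[OF assms(1) that] that by simp
  qed
  show ?thesis
    using *[of x y] *[of y x] assms by (cases "y \<le> x") (auto simp: abs_minus_commute)
qed

lemma slope_class_continuous_on:
  assumes "slope_class a b \<delta> M h" "0 \<le> \<delta>" "0 \<le> M"
  shows "continuous_on {a..b} h"
proof (rule lipschitz_on_continuous_on)
  show "M-lipschitz_on {a..b} h"
    using slope_class_lipschitz[OF assms(1,2)] assms(3)
    by (auto simp: lipschitz_on_def dist_real_def)
qed

lemma slope_class_image: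
  assumes "slope_class a b \<delta> M h" "0 \<le> \<delta>" "0 \<le> M" "a \<le> b"
  shows "h ` {a..b} = {a..b}"
proof
  show "h ` {a..b} \<subseteq> {a..b}" using slope_class_in[OF assms(1)] by blast
  have "h a = a" "h b = b" using assms(1) by (auto simp: slope_class_def)
  then show "{a..b} \<subseteq> h ` {a..b}"
    using IVT'[of h a _ b] slope_class_continuous_on[OF assms(1-3)] assms(4) by fastforce
qed

lemma slope_class_funpow_in:
  assumes "slope_class a b \<delta> M h" "x \<in> {a..b}"
  shows "(h ^^ i) x \<in> {a..b}"
  using assms slope_class_in[OF assms(1)] by (cases i) auto

lemma slope_class_funpow_fix:
  assumes "slope_class a b \<delta> M h"
  shows "(h ^^ i) a = a" "(h ^^ i) b = b"
  using assms by (induction i) (auto simp: slope_class_def)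

lemma slope_class_funpow_slopes:
  assumes h: "slope_class a b \<delta> M h" and "0 \<le> \<delta>" "0 \<le> M"
    and x: "x \<in> {a..b}" and y: "y \<in> {a..b}" and "y \<le> x"
  shows "\<delta> ^ i * (x - y) \<le> (h ^^ i) x - (h ^^ i) y \<and> (h ^^ i) x - (h ^^ i) y \<le> M ^ i * (x - y)"
proof (induction i)
  case 0
  show ?case by simp
next
  case (Suc i)
  let ?u = "(h ^^ i) x" and ?v = "(h ^^ i) y"
  \<comment> \<open>The lower bound keeps the two iterates in order, which the one-step slope bounds
    require.\<close>
  have "0 \<le> \<delta> ^ i * (x - y)" using assms by simp
  then have le: "?v \<le> ?u" using Suc by linarith
  note in_ab = slope_class_funpow_in[OF h x, of i] slope_class_funpow_in[OF h y, of i]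
  have "\<delta> * (\<delta> ^ i * (x - y)) \<le> \<delta> * (?u - ?v)" "M * (?u - ?v) \<le> M * (M ^ i * (x - y))"
    using Suc assms by (auto intro: mult_left_mono)
  then show ?case
    using slope_class_lower[OF h in_ab le] slope_class_upper[OF h in_ab le] by (simp add: mult.assoc)
qed

text \<open>With u and v the i-th iterates, h u - h' v = (h u - h v) + (h v - h' v). The first
  summand is at most M times the previous error, the second at most \<rho>; starting from error 0,
  this recursion produces the geometric sum.\<close>

lemma slope_class_funpow_diff:
  assumes h: "slope_class a b \<delta> M h" and h': "slope_class a b \<delta> M h'"
    and "0 \<le> \<delta>" "0 \<le> M" and diff: "\<And>t. \<bar>h t - h' t\<bar> \<le> \<rho>" and x: "x \<in> {a..b}"
  shows "\<bar>(h ^^ i) x - (h' ^^ i) x\<bar> \<le> (\<Sum>j<i. M ^ j) * \<rho>"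
proof (induction i)
  case 0
  show ?case by simp
next
  case (Suc i)
  let ?u = "(h ^^ i) x" and ?v = "(h' ^^ i) x"
  have "\<bar>h ?u - h ?v\<bar> \<le> M * \<bar>?u - ?v\<bar>"
    by (intro slope_class_lipschitz[OF h] assms slope_class_funpow_in[OF h x] slope_class_funpow_in[OF h' x])
  also have "\<dots> \<le> M * ((\<Sum>j<i. M ^ j) * \<rho>)" using Suc assms by (intro mult_left_mono)
  finally have "\<bar>h ?u - h' ?v\<bar> \<le> M * ((\<Sum>j<i. M ^ j) * \<rho>) + \<rho>" using diff[of ?v] by linarith
  moreover have "(\<Sum>j<Suc i. M ^ j) = 1 + M * (\<Sum>j<i. M ^ j)"
    by (simp add: sum.lessThan_Suc_shift sum_distrib_left del: sum.lessThan_Suc)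
  ultimately show ?case by (simp add: algebra_simps)
qed

locale iterative_equation =
  fixes n :: nat and w :: "nat \<Rightarrow> real" and a b \<delta> M :: real and H :: "real \<Rightarrow> real"
    and L :: "(real \<Rightarrow> real) \<Rightarrow> real \<Rightarrow> real" and K0 K1 K2 :: real
  defines "L \<equiv> \<lambda>h x. \<Sum>i<n. w i * (h ^^ i) x"
    and "K0 \<equiv> \<Sum>i<n. w i * \<delta> ^ i"
    and "K1 \<equiv> \<Sum>i<n. w i * M ^ i"
    and "K2 \<equiv> \<Sum>i<n. w i * (\<Sum>j<i. M ^ j)"
  assumes w_nonneg: "i < n \<Longrightarrow> 0 \<le> w i" and w_sum: "(\<Sum>i<n. w i) = 1"
    and ab: "a < b" and delta: "0 < \<delta>" "\<delta> \<le> 1" and M: "1 \<le> M"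
    and H: "slope_class a b (K1 * \<delta>) (K0 * M) H" and K2_less: "K2 < K0"
begin

lemma K2_nonneg: "0 \<le> K2"
  unfolding K2_def using M w_nonneg by (auto intro!: sum_nonneg mult_nonneg_nonneg)

lemma K0_pos: "0 < K0"
  using K2_nonneg K2_less by linarith

lemma K0_le_K1: "K0 \<le> K1"
  unfolding K0_def K1_def
  using delta M w_nonneg by (intro sum_mono mult_left_mono power_mono) auto

lemma K1_pos: "0 < K1"
  using K0_pos K0_le_K1 by linarith

text \<open>The i-th iterate has slopes in [\<delta>^i, M^i]; the nonnegative weights carry these
  bounds over to the sum.\<close>

lemma L_slopes:
  assumes h: "slope_class a b \<delta> M h" and "x \<in> {a..b}" "y \<in> {a..b}" "y \<le> x"
  shows "K0 * (x - y) \<le> L h x - L h y" "L h x - L h y \<le> K1 * (x - y)"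
proof -
  have *: "\<delta> ^ i * (x - y) \<le> (h ^^ i) x - (h ^^ i) y \<and> (h ^^ i) x - (h ^^ i) y \<le> M ^ i * (x - y)" for i
    using slope_class_funpow_slopes[OF h _ _ assms(2-4)] delta M by simp
  have L_diff: "L h x - L h y = (\<Sum>i<n. w i * ((h ^^ i) x - (h ^^ i) y))"
    by (simp add: L_def sum_subtractf right_diff_distrib)
  show "K0 * (x - y) \<le> L h x - L h y"
    unfolding L_diff K0_def sum_distrib_right mult.assoc
    using * w_nonneg by (intro sum_mono mult_left_mono) auto
  show "L h x - L h y \<le> K1 * (x - y)"
    unfolding L_diff K1_def sum_distrib_right mult.assoc
    using * w_nonneg by (intro sum_mono mult_left_mono) auto
qed

text \<open>All iterates fix the endpoints and the weights sum to 1. These values feed the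
  intermediate value theorem in \<open>L_surj\<close>.\<close>

lemma L_endpoints:
  assumes "slope_class a b \<delta> M h"
  shows "L h a = a" "L h b = b"
  using w_sum by (simp_all add: L_def slope_class_funpow_fix[OF assms] flip: sum_distrib_right)

text \<open>Says that the inverse of \<open>L h\<close> on [a,b] is Lipschitz with constant 1/K0.
  Injectivity, the contraction estimate and the continuity of solutions all rest on it.\<close>

lemma L_expansive:
  assumes h: "slope_class a b \<delta> M h" and "x \<in> {a..b}" "y \<in> {a..b}"
  shows "K0 * \<bar>x - y\<bar> \<le> \<bar>L h x - L h y\<bar>"
proof -
  have *: "K0 * \<bar>x - y\<bar> \<le> \<bar>L h x - L h y\<bar>" if "x \<in> {a..b}" "y \<in> {a..b}" "y \<le> x" for x y
    using L_slopes(1)[OF h that] that by simp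
  show ?thesis
    using *[of x y] *[of y x] assms by (cases "y \<le> x") (auto simp: abs_minus_commute)
qed

lemma L_inj:
  assumes "slope_class a b \<delta> M h" "x \<in> {a..b}" "y \<in> {a..b}" "L h x = L h y"
  shows "x = y"
  using L_expansive[OF assms(1-3)] assms(4) K0_pos by (simp add: mult_le_0_iff)

lemma L_surj:
  assumes h: "slope_class a b \<delta> M h" and "z \<in> {a..b}"
  obtains y where "y \<in> {a..b}" "L h y = z"
proof -
  have "continuous_on {a..b} (h ^^ i)" for i
  proof (induction i)
    case 0
    show ?case by (simp add: continuous_on_id)
  next
    case (Suc i)
    have "(h ^^ i) ` {a..b} \<subseteq> {a..b}" using slope_class_funpow_in[OF h] by blast
    then have "continuous_on ((h ^^ i) ` {a..b}) h"
      using slope_class_continuous_on[OF h] delta M continuous_on_subset by fastforce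
    then show ?case using continuous_on_compose[OF Suc] by (simp add: o_def)
  qed
  then have "continuous_on {a..b} (L h)" unfolding L_def by (intro continuous_intros)
  then obtain y where "a \<le> y" "y \<le> b" "L h y = z"
    using IVT'[of "L h" a z b] L_endpoints[OF h] assms(2) ab by auto
  then show thesis using that by simp
qed

section \<open>The fixed-point operator\<close>

text \<open>This is the inverse of \<open>L h\<close> on [a,b] composed with H. The choice is
  meaningful at every real x because H maps the whole line into [a,b], and it is unambiguous by
  \<open>L_inj\<close> when h is in the class.\<close>

definition T :: "(real \<Rightarrow> real) \<Rightarrow> real \<Rightarrow> real" where
  "T h x = (SOME y. y \<in> {a..b} \<and> L h y = H x)"

lemma T_spec:
  assumes "slope_class a b \<delta> M h"
  shows "T h x \<in> {a..b}" "L h (T h x) = H x"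
proof -
  have "\<exists>y. y \<in> {a..b} \<and> L h y = H x"
    using L_surj[OF assms slope_class_in[OF H]] by blast
  then have "T h x \<in> {a..b} \<and> L h (T h x) = H x" unfolding T_def by (rule someI_ex)
  then show "T h x \<in> {a..b}" "L h (T h x) = H x" by auto
qed

lemma T_eqI:
  assumes "slope_class a b \<delta> M h" "y \<in> {a..b}" "L h y = H x"
  shows "T h x = y"
  by (rule L_inj[OF assms(1) T_spec(1)[OF assms(1)] assms(2)]) (simp add: T_spec(2)[OF assms(1)] assms(3))

text \<open>Slopes of \<open>T h\<close> are slopes of H divided by slopes of \<open>L h\<close>: at
  least K1 * \<delta> over at most K1, and at most K0 * M over at least K0. This is why H is taken
  with exactly these bounds.\<close>

lemma T_slope_class:
  assumes h: "slope_class a b \<delta> M h"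
  shows "slope_class a b \<delta> M (T h)"
proof -
  have H_fix: "H a = a" "H b = b" using H by (auto simp: slope_class_def)
  have "\<delta> * (x - y) \<le> T h x - T h y \<and> T h x - T h y \<le> M * (x - y)"
    if x: "x \<in> {a..b}" and y: "y \<in> {a..b}" and "y \<le> x" for x y
  proof -
    note T_in = T_spec(1)[OF h, of x] T_spec(1)[OF h, of y]
    have lower: "K1 * \<delta> * (x - y) \<le> H x - H y" and upper: "H x - H y \<le> K0 * M * (x - y)"
      using slope_class_lower[OF H x y that(3)] slope_class_upper[OF H x y that(3)] by auto
    have "0 \<le> K1 * \<delta> * (x - y)" using K1_pos delta that by simp
    \<comment> \<open>Since \<open>L h\<close> is strictly increasing on [a,b],
      \<open>T h x < T h y\<close> would make this difference negative; hence \<open>T h\<close> is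
      monotone and \<open>L_slopes\<close> applies to its values.\<close>
    then have "0 \<le> L h (T h x) - L h (T h y)" using lower T_spec(2)[OF h] by simp
    moreover have "K0 * (T h y - T h x) \<le> L h (T h y) - L h (T h x)" if "T h x < T h y"
      using L_slopes(1)[OF h T_in(2,1)] that by simp
    moreover have "0 < K0 * (T h y - T h x)" if "T h x < T h y"
      using K0_pos that by simp
    ultimately have le: "T h y \<le> T h x" by fastforce
    have "K0 * (T h x - T h y) \<le> K0 * (M * (x - y))" "K1 * (\<delta> * (x - y)) \<le> K1 * (T h x - T h y)"
      using L_slopes[OF h T_in le] lower upper T_spec(2)[OF h] by (auto simp: mult.assoc)
    then show ?thesis using K0_pos K1_pos by simp
  qed
  moreover have "T h a = a" "T h b = b"
    using ab by (auto intro!: T_eqI[OF h] simp: L_endpoints[OF h] H_fix)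
  moreover have "range (T h) \<subseteq> {a..b}" using T_spec(1)[OF h] by blast
  ultimately show ?thesis unfolding slope_class_def by blast
qed

lemma T_contraction:
  assumes h: "slope_class a b \<delta> M h" and h': "slope_class a b \<delta> M h'"
    and diff: "\<And>t. \<bar>h t - h' t\<bar> \<le> \<rho>"
  shows "\<bar>T h x - T h' x\<bar> \<le> K2 / K0 * \<rho>"
proof -
  let ?y = "T h' x"
  have y: "?y \<in> {a..b}" by (rule T_spec(1)[OF h'])
  have "K0 * \<bar>T h x - ?y\<bar> \<le> \<bar>L h (T h x) - L h ?y\<bar>"
    by (rule L_expansive[OF h T_spec(1)[OF h] y])
  \<comment> \<open>\<open>L h (T h x)\<close> and \<open>L h' ?y\<close> both equal
    \<open>H x\<close>, so only the two operators at the common point \<open>?y\<close> remain to be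
    compared.\<close>
  also have "\<dots> = \<bar>L h ?y - L h' ?y\<bar>" using T_spec(2)[OF h] T_spec(2)[OF h'] by (simp add: abs_minus_commute)
  also have "\<dots> = \<bar>\<Sum>i<n. w i * ((h ^^ i) ?y - (h' ^^ i) ?y)\<bar>"
    by (simp add: L_def sum_subtractf right_diff_distrib)
  also have "\<dots> \<le> (\<Sum>i<n. w i * ((\<Sum>j<i. M ^ j) * \<rho>))"
  proof (rule sum_abs[THEN order_trans], rule sum_mono)
    fix i assume "i \<in> {..<n}"
    then show "\<bar>w i * ((h ^^ i) ?y - (h' ^^ i) ?y)\<bar> \<le> w i * ((\<Sum>j<i. M ^ j) * \<rho>)"
      using slope_class_funpow_diff[OF h h' _ _ diff y, of i] delta M w_nonneg[of i]
      by (auto simp: abs_mult intro!: mult_left_mono)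
  qed
  also have "\<dots> = K2 * \<rho>" by (simp add: K2_def sum_distrib_right mult.assoc)
  finally show ?thesis using K0_pos by (simp add: field_simps)
qed

section \<open>Uniqueness of the solution\<close>

definition solution :: "(real \<Rightarrow> real) \<Rightarrow> bool" where
  "solution h \<longleftrightarrow> slope_class a b \<delta> M h \<and> (\<forall>t. (\<Sum>i<n. w i * (h ^^ Suc i) t) = H t)"

text \<open>Reading \<open>h ^^ Suc i\<close> as \<open>h ^^ i\<close> applied after h turns the
  equation into the fixed-point condition for T.\<close>

lemma solution_iff: "solution h \<longleftrightarrow> slope_class a b \<delta> M h \<and> (\<forall>t. L h (h t) = H t)"
  by (simp add: solution_def L_def funpow_swap1)

lemma ratio: "0 \<le> K2 / K0" "K2 / K0 < 1"
  using K2_nonneg K2_less K0_pos by auto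

lemma solution_unique:
  assumes "solution h" "solution h'"
  shows "h = h'"
proof
  fix t
  have h: "slope_class a b \<delta> M h" and h': "slope_class a b \<delta> M h'"
    using assms by (auto simp: solution_iff)
  have fixed: "T h = h" "T h' = h'"
    using assms slope_class_in[OF h] slope_class_in[OF h'] by (auto simp: solution_iff intro!: T_eqI)
  \<comment> \<open>Values in [a,b] differ by at most b - a, and each use of the contraction on the
    two fixed points gains a factor K2 / K0. The bound is kept uniform in x because
    \<open>T_contraction\<close> needs a uniform distance.\<close>
  have bound: "\<bar>h x - h' x\<bar> \<le> (K2 / K0) ^ m * (b - a)" for m x
  proof (induction m arbitrary: x)
    case 0
    show ?case using slope_class_in[OF h, of x] slope_class_in[OF h', of x] by auto
  next
    case (Suc m)
    show ?case using T_contraction[OF h h' Suc, of x] by (simp add: fixed)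
  qed
  have "(\<lambda>m. (K2 / K0) ^ m * (b - a)) \<longlonglongrightarrow> 0"
    using ratio by (intro tendsto_mult_left_zero LIMSEQ_power_zero) auto
  then have "\<bar>h t - h' t\<bar> \<le> 0"
    by (rule LIMSEQ_le_const) (use bound in blast)
  then show "h t = h' t" by simp
qed

section \<open>Existence by Picard iteration\<close>

text \<open>The starting map is the identity of [a,b] extended by constants. It lies in the class
  because \<delta> \<le> 1 \<le> M.\<close>

definition picard :: "nat \<Rightarrow> real \<Rightarrow> real" where
  "picard m = (T ^^ m) (\<lambda>x. max a (min b x))"

lemma picard_slope_class: "slope_class a b \<delta> M (picard m)"
proof (induction m)
  case 0
  have "\<delta> * (x - y) \<le> x - y \<and> x - y \<le> M * (x - y)" if "y \<le> x" for x y :: real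
    using that delta M mult_right_mono[of \<delta> 1 "x - y"] mult_right_mono[of 1 M "x - y"] by simp
  then show ?case using ab by (auto simp: picard_def slope_class_def)
next
  case (Suc m)
  then show ?case using T_slope_class by (simp add: picard_def)
qed

text \<open>Consecutive iterates differ by at most a term of a convergent geometric series, so the
  telescoping sums converge.\<close>

lemma picard_convergent: "convergent (\<lambda>m. picard m x)"
proof -
  have bound: "\<bar>picard (Suc m) x - picard m x\<bar> \<le> (K2 / K0) ^ m * (b - a)" for m x
  proof (induction m arbitrary: x)
    case 0
    show ?case
      using slope_class_in[OF picard_slope_class, of 0 x] slope_class_in[OF picard_slope_class, of 1 x] by auto
  next
    case (Suc m)
    show ?case
      using T_contraction[OF picard_slope_class picard_slope_class Suc, of x] by (simp add: picard_def)
  qed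
  have "summable (\<lambda>m. (K2 / K0) ^ m * (b - a))"
    using ratio by (intro summable_mult2 summable_geometric) auto
  then have "summable (\<lambda>m. picard (Suc m) x - picard m x)"
    by (rule summable_comparison_test') (use bound in simp)
  then have "convergent (\<lambda>m. \<Sum>i<m. picard (Suc i) x - picard i x)"
    by (simp add: summable_iff_convergent)
  then have "convergent (\<lambda>m. picard m x - picard 0 x)"
    by (simp add: sum_lessThan_telescope[of "\<lambda>i. picard i x"])
  then show ?thesis using convergent_diff_const_right_iff by blast
qed

definition limit_solution :: "real \<Rightarrow> real" where
  "limit_solution x = lim (\<lambda>m. picard m x)"

lemma picard_tendsto: "(\<lambda>m. picard m x) \<longlonglongrightarrow> limit_solution x"
  unfolding limit_solution_def using picard_convergent by (simp add: convergent_LIMSEQ_iff)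

text \<open>Every condition of the class is an equation or a non-strict inequality between values,
  hence survives pointwise limits.\<close>

lemma limit_slope_class: "slope_class a b \<delta> M limit_solution"
proof -
  have "limit_solution x \<in> {a..b}" for x
    by (rule Lim_in_closed_set[OF _ _ _ picard_tendsto])
       (use slope_class_in[OF picard_slope_class] in auto)
  moreover have "limit_solution a = a" "limit_solution b = b"
    using picard_slope_class by (auto simp: limit_solution_def slope_class_def)
  moreover have "\<delta> * (x - y) \<le> limit_solution x - limit_solution y \<and>
      limit_solution x - limit_solution y \<le> M * (x - y)"
    if "x \<in> {a..b}" "y \<in> {a..b}" "y \<le> x" for x y
    using slope_class_lower[OF picard_slope_class that] slope_class_upper[OF picard_slope_class that]
    by (blast intro: LIMSEQ_le_const LIMSEQ_le_const2 tendsto_diff picard_tendsto)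
  ultimately show ?thesis unfolding slope_class_def by blast
qed

text \<open>Equi-Lipschitz continuity of the iterates lets pointwise convergence pass through compositions.\<close>

lemma picard_tendsto_at:
  assumes y: "\<And>m. y m \<in> {a..b}" and "y \<longlonglongrightarrow> z"
  shows "(\<lambda>m. picard m (y m)) \<longlonglongrightarrow> limit_solution z"
proof -
  have z: "z \<in> {a..b}" by (rule Lim_in_closed_set[OF _ _ _ assms(2)]) (use y in auto)
  have "(\<lambda>m. picard m (y m) - picard m z) \<longlonglongrightarrow> 0"
  proof (rule Lim_null_comparison)
    show "\<forall>\<^sub>F m in sequentially. norm (picard m (y m) - picard m z) \<le> M * \<bar>y m - z\<bar>"
      using slope_class_lipschitz[OF picard_slope_class _ y z] delta by simp
    have "(\<lambda>m. y m - z) \<longlonglongrightarrow> 0" using assms(2) LIM_zero by blast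
    then show "(\<lambda>m. M * \<bar>y m - z\<bar>) \<longlonglongrightarrow> 0" by (intro tendsto_mult_right_zero tendsto_rabs_zero)
  qed
  from tendsto_add[OF this picard_tendsto[of z]] show ?thesis by simp
qed

lemma limit_is_solution: "solution limit_solution"
proof -
  have "L limit_solution (limit_solution t) = H t" for t
  proof -
    \<comment> \<open>Evaluating at the next iterate makes \<open>L (picard m) (y m) = H t\<close>
      hold exactly for every m, by the choice of T; the limit of y is still
      \<open>limit_solution t\<close>.\<close>
    define y where "y m = picard (Suc m) t" for m
    have y_in: "y m \<in> {a..b}" for m unfolding y_def by (rule slope_class_in[OF picard_slope_class])
    have "(\<lambda>m. (picard m ^^ i) (y m)) \<longlonglongrightarrow> (limit_solution ^^ i) (limit_solution t)" for i
    proof (induction i)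
      case 0
      show ?case using LIMSEQ_Suc[OF picard_tendsto] by (simp add: y_def)
    next
      case (Suc i)
      have "(picard m ^^ i) (y m) \<in> {a..b}" for m
        by (rule slope_class_funpow_in[OF picard_slope_class y_in])
      from picard_tendsto_at[OF this Suc] show ?case by simp
    qed
    then have "(\<lambda>m. L (picard m) (y m)) \<longlonglongrightarrow> L limit_solution (limit_solution t)"
      unfolding L_def by (intro tendsto_intros)
    moreover have "L (picard m) (y m) = H t" for m
      using T_spec(2)[OF picard_slope_class, of m t] by (simp add: y_def picard_def)
    ultimately show ?thesis by (simp add: LIMSEQ_const_iff)
  qed
  then show ?thesis by (simp add: solution_iff limit_slope_class)
qed

text \<open>The slope bounds give continuity on [a,b] only. On the whole line, h inherits it from H,
  since \<open>L h (h t) = H t\<close> and \<open>L h\<close> expands distances by at least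
  K0.\<close>

lemma solution_continuous:
  assumes "solution h" and H_cont: "continuous_on UNIV H"
  shows "continuous_on UNIV h"
proof -
  have h: "slope_class a b \<delta> M h" and eq: "\<And>t. L h (h t) = H t"
    using assms(1) by (auto simp: solution_iff)
  have le: "\<bar>h s - h t\<bar> \<le> \<bar>H s - H t\<bar> / K0" for s t
    using L_expansive[OF h slope_class_in[OF h] slope_class_in[OF h], of s t] K0_pos
    by (simp add: eq field_simps)
  have "(h \<longlongrightarrow> h t) (at t)" for t
  proof (rule LIM_zero_cancel, rule Lim_null_comparison)
    show "\<forall>\<^sub>F s in at t. norm (h s - h t) \<le> \<bar>H s - H t\<bar> / K0" using le by simp
    have "(H \<longlongrightarrow> H t) (at t)" using H_cont by (simp add: continuous_on_def)
    then show "((\<lambda>s. \<bar>H s - H t\<bar> / K0) \<longlongrightarrow> 0) (at t)"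
      by (intro tendsto_divide_zero tendsto_rabs_zero LIM_zero)
  qed
  then show ?thesis by (simp add: continuous_on_def)
qed

end

section \<open>Logarithmic coordinates\<close>

definition to_log :: "(real \<Rightarrow> real) \<Rightarrow> real \<Rightarrow> real" where
  "to_log g t = ln (g (exp t))"

text \<open>The restriction puts the result in the extensional function space, so that
  \<open>to_log\<close> is undone with HOL equality.\<close>

definition of_log :: "(real \<Rightarrow> real) \<Rightarrow> real \<Rightarrow> real" where
  "of_log h = restrict (\<lambda>x. exp (h (ln x))) Rplus"

lemma of_log_to_log:
  assumes "g \<in> Rplus \<rightarrow>\<^sub>E Rplus"
  shows "of_log (to_log g) = g"
proof
  fix x
  show "of_log (to_log g) x = g x"
    using assms by (cases "x > 0") (auto simp: of_log_def to_log_def PiE_iff extensional_def)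
qed

lemma to_log_of_log: "to_log (of_log h) = h"
  by (auto simp: of_log_def to_log_def)

lemma to_log_funpow:
  assumes "g \<in> Rplus \<rightarrow> Rplus"
  shows "(g ^^ k) (exp t) = exp ((to_log g ^^ k) t)"
proof (induction k)
  case (Suc k)
  \<comment> \<open>Positivity lets exp undo ln between consecutive iterates.\<close>
  have "0 < g (exp s)" for s using assms by auto
  then show ?case using Suc by (simp add: to_log_def)
qed simp

lemma powr_slope_iff:
  fixes x y u v p :: real
  assumes "0 < x" "0 < y" "0 < u" "0 < v"
  shows "(x / y) powr p \<le> u / v \<longleftrightarrow> p * (ln x - ln y) \<le> ln u - ln v"
    and "u / v \<le> (x / y) powr p \<longleftrightarrow> ln u - ln v \<le> p * (ln x - ln y)"
proof -
  have "(x / y) powr p = exp (p * (ln x - ln y))" "u / v = exp (ln u - ln v)"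
    using assms by (simp_all add: powr_def ln_div exp_diff)
  then show "(x / y) powr p \<le> u / v \<longleftrightarrow> p * (ln x - ln y) \<le> ln u - ln v"
    and "u / v \<le> (x / y) powr p \<longleftrightarrow> ln u - ln v \<le> p * (ln x - ln y)" by simp_all
qed

lemma GJ_pos: "g \<in> GJ c d \<delta> M \<Longrightarrow> g \<in> Rplus \<rightarrow>\<^sub>E Rplus"
  by (simp add: GJ_def Cb_Rplus_def)

lemma GJ_to_log:
  assumes g: "g \<in> GJ c d \<delta> M" and "0 < c" "c < d"
  shows "slope_class (ln c) (ln d) \<delta> M (to_log g)" "continuous_on UNIV (to_log g)"
proof -
  have d: "0 < d" using assms by simp
  have pos: "0 < g (exp t)" for t using PiE_mem[OF GJ_pos[OF g], of "exp t"] by simp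
  have range: "g (exp t) \<in> {c..d}" for t
    using g imageI[of "exp t" Rplus g] by (simp add: GJ_def)
  have exp_in: "exp t \<in> {c..d}" if "t \<in> {ln c..ln d}" for t
    using that assms(2) d exp_le_cancel_iff[of "ln c" t] by (simp add: ln_ge_iff)
  have "\<delta> * (s - t) \<le> to_log g s - to_log g t \<and> to_log g s - to_log g t \<le> M * (s - t)"
    if "s \<in> {ln c..ln d}" "t \<in> {ln c..ln d}" "t \<le> s" for s t
  proof -
    have "(exp s / exp t) powr \<delta> \<le> g (exp s) / g (exp t) \<and> g (exp s) / g (exp t) \<le> (exp s / exp t) powr M"
      using g exp_in[OF that(1)] exp_in[OF that(2)] that(3) by (simp add: GJ_def)
    then show ?thesis by (simp add: powr_slope_iff pos to_log_def)
  qed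
  moreover have "to_log g t \<in> {ln c..ln d}" for t
    using range[of t] pos[of t] assms(2) d by (simp add: to_log_def)
  moreover have "to_log g (ln c) = ln c" "to_log g (ln d) = ln d"
    using g assms by (simp_all add: to_log_def GJ_def)
  ultimately show "slope_class (ln c) (ln d) \<delta> M (to_log g)" unfolding slope_class_def by blast
  have "continuous_on Rplus g" using g by (simp add: GJ_def Cb_Rplus_def)
  then have "continuous_on UNIV (\<lambda>t. g (exp t))"
    by (rule continuous_on_compose2) (auto intro: continuous_on_exp continuous_on_id)
  then show "continuous_on UNIV (to_log g)"
    unfolding to_log_def using pos by (intro continuous_on_ln) (simp_all add: order_less_imp_not_eq2)
qed

lemma of_log_GJ:
  assumes h: "slope_class (ln c) (ln d) \<delta> M h" and cont: "continuous_on UNIV h"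
    and "0 < c" "c < d" "0 \<le> \<delta>" "0 \<le> M"
  shows "of_log h \<in> GJ c d \<delta> M"
proof -
  have val: "of_log h x = exp (h (ln x))" if "0 < x" for x using that by (simp add: of_log_def)
  have in_cd: "of_log h x \<in> {c..d}" if "0 < x" for x
    using slope_class_in[OF h, of "ln x"] that assms(3,4) exp_le_cancel_iff[of "ln c" "h (ln x)"]
    by (simp add: val ln_ge_iff)
  \<comment> \<open>The class only places the range inside the interval; that it is all of it comes
    from the fixed endpoints and continuity, through \<open>slope_class_image\<close>.\<close>
  have "{c..d} \<subseteq> of_log h ` Rplus"
  proof
    fix z assume z: "z \<in> {c..d}"
    then have "ln z \<in> h ` {ln c..ln d}"
      using assms by (subst slope_class_image[OF h]) auto
    then obtain t where "ln z = h t" by blast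
    then have "z = of_log h (exp t)" using z assms by (simp add: val) (metis exp_ln less_le_trans)
    then show "z \<in> of_log h ` Rplus" by auto
  qed
  then have range: "of_log h ` Rplus = {c..d}" using in_cd by fastforce
  have "continuous_on Rplus (\<lambda>x. exp (h (ln x)))"
    by (intro continuous_on_exp continuous_on_compose2[OF cont] continuous_on_ln continuous_on_id) auto
  then have "continuous_on Rplus (of_log h)"
    by (rule continuous_on_eq) (simp add: val)
  moreover have "of_log h \<in> Rplus \<rightarrow>\<^sub>E Rplus" by (simp add: of_log_def)
  ultimately have "of_log h \<in> Cb_Rplus" by (simp add: Cb_Rplus_def range)
  moreover have "of_log h c = c" "of_log h d = d"
    using h assms by (simp_all add: val slope_class_def)
  moreover have "(x / y) powr \<delta> \<le> of_log h x / of_log h y \<and> of_log h x / of_log h y \<le> (x / y) powr M"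
    if "x \<in> {c..d}" "y \<in> {c..d}" "y \<le> x" for x y
  proof -
    have "0 < x" "0 < y" "ln x \<in> {ln c..ln d}" "ln y \<in> {ln c..ln d}" "ln y \<le> ln x"
      using that assms by auto
    then show ?thesis
      using slope_class_lower[OF h, of "ln x" "ln y"] slope_class_upper[OF h, of "ln x" "ln y"]
      by (simp add: powr_slope_iff val)
  qed
  ultimately show ?thesis by (simp add: GJ_def range)
qed

lemma equation_to_log:
  assumes g: "g \<in> Rplus \<rightarrow>\<^sub>E Rplus" and G: "G \<in> Rplus \<rightarrow>\<^sub>E Rplus"
  shows "(\<forall>x\<in>Rplus. (\<Prod>k=1..n. ((g ^^ k) x) powr (\<alpha> k)) = G x) \<longleftrightarrow>
    (\<forall>t. (\<Sum>i<n. \<alpha> (Suc i) * (to_log g ^^ Suc i) t) = to_log G t)"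
proof -
  have lhs: "(\<Prod>k=1..n. ((g ^^ k) (exp t)) powr (\<alpha> k)) = exp (\<Sum>i<n. \<alpha> (Suc i) * (to_log g ^^ Suc i) t)" for t
  proof -
    have "(\<Prod>k=1..n. ((g ^^ k) (exp t)) powr (\<alpha> k)) = (\<Prod>k=1..n. exp (\<alpha> k * (to_log g ^^ k) t))"
      using g by (intro prod.cong refl) (simp add: to_log_funpow powr_def PiE_def)
    also have "\<dots> = exp (\<Sum>k=1..n. \<alpha> k * (to_log g ^^ k) t)" by (simp add: exp_sum)
    also have "(\<Sum>k=1..n. \<alpha> k * (to_log g ^^ k) t) = (\<Sum>i<n. \<alpha> (Suc i) * (to_log g ^^ Suc i) t)"
      by (simp only: One_nat_def sum.atLeast_Suc_atMost_Suc_shift sum.atLeast1_atMost_eq)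
    finally show ?thesis .
  qed
  have "0 < G (exp t)" for t using PiE_mem[OF G, of "exp t"] by simp
  then have rhs: "G (exp t) = exp (to_log G t)" for t by (simp add: to_log_def)
  \<comment> \<open>Surjectivity of exp onto \<open>Rplus\<close> turns the quantifier over positive
    x into one over all real t.\<close>
  have "Rplus = range (exp :: real \<Rightarrow> real)"
    by (auto intro!: range_eqI exp_ln[symmetric])
  then show ?thesis by (simp only: ball_simps lhs rhs exp_inj_iff UNIV_I simp_thms)
qed

section \<open>Transfer to the multiplicative equation\<close>

theorem theorem1:
  fixes n :: nat and \<alpha> :: "nat \<Rightarrow> real" and c d \<delta> M K0 K1 K2 :: real
    and G :: "real \<Rightarrow> real"
  assumes "n \<ge> 1"
    and "0 < \<alpha> 1" and "\<alpha> 1 < 1"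
    and "\<And>k. 2 \<le> k \<Longrightarrow> k \<le> n \<Longrightarrow> \<alpha> k \<ge> 0"
    and "(\<Sum>k=1..n. \<alpha> k) = 1"
    and "0 < c" and "c < d"
    and "0 < \<delta>" and "\<delta> \<le> 1" and "1 \<le> M"
    and "K0 = (\<Sum>k=1..n. \<alpha> k * \<delta> ^ (k - 1))"
    and "K1 = (\<Sum>k=1..n. \<alpha> k * M ^ (k - 1))"
    and "K2 = (\<Sum>k=2..n. \<alpha> k * (\<Sum>j=0..k-2. M ^ j))"
    and "G \<in> GJ c d (K1 * \<delta>) (K0 * M)"
    and "K2 < K0"
  shows "\<exists>!g. g \<in> GJ c d \<delta> M \<and>
           (\<forall>x\<in>Rplus. (\<Prod>k=1..n. ((g ^^ k) x) powr (\<alpha> k)) = G x)"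
proof -
  let ?w = "\<lambda>i. \<alpha> (Suc i)"
  have shift: "(\<Sum>k=1..n. f k) = (\<Sum>i<n. f (Suc i))" for f :: "nat \<Rightarrow> real"
    by (simp add: sum.atLeast1_atMost_eq)
  have K0: "K0 = (\<Sum>i<n. ?w i * \<delta> ^ i)" and K1: "K1 = (\<Sum>i<n. ?w i * M ^ i)"
    unfolding assms(11,12) shift by simp_all
  \<comment> \<open>The inner range is rewritten before k = 1 is added: at k = 1 the truncated k-2
    would leave the term j = 0, whereas j < k-1 gives the empty sum, so the added term
    vanishes.\<close>
  have "K2 = (\<Sum>k=2..n. \<alpha> k * (\<Sum>j<k-1. M ^ j))"
    unfolding assms(13) by (intro sum.cong refl) (auto intro!: arg_cong2[where f = "(*)"] sum.cong)
  also have "\<dots> = (\<Sum>k=1..n. \<alpha> k * (\<Sum>j<k-1. M ^ j))"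
    by (rule sum.mono_neutral_left) (auto simp: le_Suc_eq Suc_le_eq)
  finally have K2: "K2 = (\<Sum>i<n. ?w i * (\<Sum>j<i. M ^ j))" unfolding shift by simp
  note G_log = GJ_to_log[OF assms(14,6,7)]
  interpret iterative_equation n ?w "ln c" "ln d" \<delta> M "to_log G"
    "\<lambda>h x. \<Sum>i<n. ?w i * (h ^^ i) x" K0 K1 K2
  proof unfold_locales
    show "0 \<le> ?w i" if "i < n" for i
      using that assms(2) assms(4)[of "Suc i"] by (cases i) auto
  qed (use assms K0 K1 K2 G_log shift[of \<alpha>] in auto)
  have equation: "(\<forall>x\<in>Rplus. (\<Prod>k=1..n. ((g ^^ k) x) powr (\<alpha> k)) = G x) \<longleftrightarrow> solution (to_log g)"
    if "g \<in> Rplus \<rightarrow>\<^sub>E Rplus" "slope_class (ln c) (ln d) \<delta> M (to_log g)" for g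
    using that by (simp only: equation_to_log[OF that(1) GJ_pos[OF assms(14)]] solution_def simp_thms)
  show ?thesis
  proof (rule ex1I, rule conjI)
    show GJ: "of_log limit_solution \<in> GJ c d \<delta> M"
      using limit_slope_class solution_continuous[OF limit_is_solution G_log(2)] assms
      by (intro of_log_GJ) auto
    show "\<forall>x\<in>Rplus. (\<Prod>k=1..n. ((of_log limit_solution ^^ k) x) powr (\<alpha> k)) = G x"
      using equation[OF GJ_pos[OF GJ]] limit_slope_class limit_is_solution
      by (simp only: to_log_of_log)
  next
    fix g assume g: "g \<in> GJ c d \<delta> M \<and> (\<forall>x\<in>Rplus. (\<Prod>k=1..n. ((g ^^ k) x) powr (\<alpha> k)) = G x)"
    then have "solution (to_log g)"
      using equation[OF GJ_pos GJ_to_log(1)] assms(6,7) by blast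
    then have "to_log g = limit_solution" using solution_unique limit_is_solution by blast
    \<comment> \<open>Equal logarithms give equal maps because g is extensional on
      \<open>Rplus\<close>.\<close>
    then show "g = of_log limit_solution" using of_log_to_log[OF GJ_pos] g by metis
  qed
qed

end
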